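(* Let $(G,K,\theta)$ be a multiplicity-free triple (with $\theta$ irreducible on $V$, and $v\in V$ a unit vector). A non-trivial (i.e. not identically zero) function $\phi\in L(G)$ is spherical if and only if $$\sum_{k\in K}\phi(gkh)\overline{\psi(k)}=\phi(g)\phi(h)\qquad\text{for all } g,h\in G.$$
   Context: $G$ is a finite group, $K\le G$, $(\theta,V)$ an irreducible unitary $K$-representation of dimension $d_\theta$; $(G,K,\theta)$ is a multiplicity-free triple if $\mathrm{Ind}_K^G\theta$ contains every irreducible $G$-representation at most once. Inner products are conjugate-linear in the second argument. $L(G)$ is the algebra of functions $G\to\mathbb C$ with convolution $[f_1*f_2](g)=\sum_{h\in G}f_1(gh)f_2(h^{-1})$. Fix $v\in V$ with $\|v\|=1$; $\psi\in L(G)$ is $\psi(k)=\frac{d_\theta}{|K|}\langle v,\theta(k)v\rangle$ for $k\in K$, $\psi=0$ off $K$. $\mathcal H(G,K,\psi)=\{f\in L(G):f=\psi*f*\psi\}$. A function $\phi\in\mathcal H(G,K,\psi)$ is spherical if $\phi(1_G)=1$ and for every $f\in\mathcal H(G,K,\psi)$ there exists $\lambda_{\phi,f}\in\mathbb C$ with $\phi*f=\lambda_{\phi,f}\phi$. *)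

theory Defs
  imports Complex_Main "HOL-Library.FuncSet" "HOL-Library.Function_Algebras" "HOL-Algebra.Coset"
begin

section \<open>Finite-dimensional complex representations\<close>

text \<open>
  A representation space is a subspace \<open>V\<close> of an ambient complex vector space, which is a type
  together with a scalar multiplication \<open>s\<close>. A representation of a subgroup \<open>K\<close> of \<open>G\<close> is a
  representation of \<open>G\<lparr>carrier := K\<rparr>\<close>.
\<close>

definition linear_between ::
  "(complex \<Rightarrow> 'v::ab_group_add \<Rightarrow> 'v) \<Rightarrow> 'v set \<Rightarrow> (complex \<Rightarrow> 'w::ab_group_add \<Rightarrow> 'w) \<Rightarrow> 'w set
    \<Rightarrow> ('v \<Rightarrow> 'w) \<Rightarrow> bool" where
  "linear_between s V t W T \<longleftrightarrow>
     (\<forall>x\<in>V. T x \<in> W) \<and>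
     (\<forall>x\<in>V. \<forall>y\<in>V. T (x + y) = T x + T y) \<and>
     (\<forall>c. \<forall>x\<in>V. T (s c x) = t c (T x))"

definition group_rep ::
  "('g, 'b) monoid_scheme \<Rightarrow> (complex \<Rightarrow> 'v::ab_group_add \<Rightarrow> 'v) \<Rightarrow> 'v set \<Rightarrow> ('g \<Rightarrow> 'v \<Rightarrow> 'v) \<Rightarrow> bool" where
  "group_rep G s V \<rho> \<longleftrightarrow>
     vector_space s \<and> module.subspace s V \<and>
     (\<exists>B. finite B \<and> V = module.span s B) \<and>
     (\<forall>g\<in>carrier G. linear_between s V s V (\<rho> g)) \<and>
     (\<forall>x\<in>V. \<rho> \<one>\<^bsub>G\<^esub> x = x) \<and>
     (\<forall>g\<in>carrier G. \<forall>h\<in>carrier G. \<forall>x\<in>V. \<rho> (g \<otimes>\<^bsub>G\<^esub> h) x = \<rho> g (\<rho> h x))"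

definition invariant_subspace ::
  "('g, 'b) monoid_scheme \<Rightarrow> (complex \<Rightarrow> 'v::ab_group_add \<Rightarrow> 'v) \<Rightarrow> 'v set \<Rightarrow> ('g \<Rightarrow> 'v \<Rightarrow> 'v) \<Rightarrow> 'v set \<Rightarrow> bool" where
  "invariant_subspace G s V \<rho> U \<longleftrightarrow>
     module.subspace s U \<and> U \<subseteq> V \<and> (\<forall>g\<in>carrier G. \<forall>x\<in>U. \<rho> g x \<in> U)"

definition irreducible_rep ::
  "('g, 'b) monoid_scheme \<Rightarrow> (complex \<Rightarrow> 'v::ab_group_add \<Rightarrow> 'v) \<Rightarrow> 'v set \<Rightarrow> ('g \<Rightarrow> 'v \<Rightarrow> 'v) \<Rightarrow> bool" where
  "irreducible_rep G s V \<rho> \<longleftrightarrow>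
     group_rep G s V \<rho> \<and> V \<noteq> {0} \<and>
     (\<forall>U. invariant_subspace G s V \<rho> U \<longrightarrow> U = {0} \<or> U = V)"

definition equivalent_reps ::
  "('g, 'b) monoid_scheme \<Rightarrow> (complex \<Rightarrow> 'v::ab_group_add \<Rightarrow> 'v) \<Rightarrow> 'v set \<Rightarrow> ('g \<Rightarrow> 'v \<Rightarrow> 'v)
    \<Rightarrow> (complex \<Rightarrow> 'w::ab_group_add \<Rightarrow> 'w) \<Rightarrow> 'w set \<Rightarrow> ('g \<Rightarrow> 'w \<Rightarrow> 'w) \<Rightarrow> bool" where
  "equivalent_reps G s V \<rho> t W \<sigma> \<longleftrightarrow>
     (\<exists>T. linear_between s V t W T \<and> bij_betw T V W \<and>
          (\<forall>g\<in>carrier G. \<forall>x\<in>V. T (\<rho> g x) = \<sigma> g (T x)))"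

text \<open>\<open>\<U>\<close> is a finite set of irreducible subrepresentations of which \<open>V\<close> is the internal direct sum.
  The zero space is not irreducible, so independent summands are distinct sets, and a set of
  summands counts each of them exactly once.\<close>

definition irreducible_decomposition ::
  "('g, 'b) monoid_scheme \<Rightarrow> (complex \<Rightarrow> 'v::ab_group_add \<Rightarrow> 'v) \<Rightarrow> 'v set \<Rightarrow> ('g \<Rightarrow> 'v \<Rightarrow> 'v)
    \<Rightarrow> 'v set set \<Rightarrow> bool" where
  "irreducible_decomposition G s V \<rho> \<U> \<longleftrightarrow>
     finite \<U> \<and>
     (\<forall>U\<in>\<U>. invariant_subspace G s V \<rho> U \<and> irreducible_rep G s U \<rho>) \<and>
     (\<forall>x\<in>V. \<exists>!f. f \<in> (\<Pi>\<^sub>E U\<in>\<U>. U) \<and> x = (\<Sum>U\<in>\<U>. f U))"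

text \<open>Only irreducible representations equivalent to some summand matter, and these have copies in
  the ambient space of \<open>V\<close>; hence nothing is lost by letting \<open>W\<close> range over its subspaces.\<close>

definition multiplicity_free ::
  "('g, 'b) monoid_scheme \<Rightarrow> (complex \<Rightarrow> 'v::ab_group_add \<Rightarrow> 'v) \<Rightarrow> 'v set \<Rightarrow> ('g \<Rightarrow> 'v \<Rightarrow> 'v) \<Rightarrow> bool" where
  "multiplicity_free G s V \<rho> \<longleftrightarrow>
     (\<exists>\<U>. irreducible_decomposition G s V \<rho> \<U> \<and>
        (\<forall>W \<sigma>. irreducible_rep G s W \<sigma> \<longrightarrow> card {U \<in> \<U>. equivalent_reps G s U \<rho> s W \<sigma>} \<le> 1))"

section \<open>Unitary representations\<close>

definition hermitian_ip ::
  "(complex \<Rightarrow> 'v::ab_group_add \<Rightarrow> 'v) \<Rightarrow> 'v set \<Rightarrow> ('v \<Rightarrow> 'v \<Rightarrow> complex) \<Rightarrow> bool" where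
  "hermitian_ip s V ip \<longleftrightarrow>
     (\<forall>x\<in>V. \<forall>y\<in>V. \<forall>z\<in>V. ip (x + y) z = ip x z + ip y z) \<and>
     (\<forall>c. \<forall>x\<in>V. \<forall>y\<in>V. ip (s c x) y = c * ip x y) \<and>
     (\<forall>x\<in>V. \<forall>y\<in>V. ip y x = cnj (ip x y)) \<and>
     (\<forall>x\<in>V. x \<noteq> 0 \<longrightarrow> Re (ip x x) > 0)"

definition ip_norm :: "('v \<Rightarrow> 'v \<Rightarrow> complex) \<Rightarrow> 'v \<Rightarrow> real" where
  "ip_norm ip x = sqrt (Re (ip x x))"

definition unitary_rep ::
  "('g, 'b) monoid_scheme \<Rightarrow> (complex \<Rightarrow> 'v::ab_group_add \<Rightarrow> 'v) \<Rightarrow> ('v \<Rightarrow> 'v \<Rightarrow> complex) \<Rightarrow> 'v set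
    \<Rightarrow> ('g \<Rightarrow> 'v \<Rightarrow> 'v) \<Rightarrow> bool" where
  "unitary_rep G s ip V \<rho> \<longleftrightarrow>
     group_rep G s V \<rho> \<and> hermitian_ip s V ip \<and>
     (\<forall>g\<in>carrier G. \<forall>x\<in>V. \<forall>y\<in>V. ip (\<rho> g x) (\<rho> g y) = ip x y)"

section \<open>Induced representations and multiplicity-free triples\<close>

text \<open>The functions \<open>F\<close> from \<open>G\<close> to \<open>V\<close> with \<open>F(gk) = \<theta>(k\<^sup>-\<^sup>1) F(g)\<close>, under left translation.
  Functions on \<open>G\<close> are extended by \<open>0\<close> off the carrier, here and in \<open>group_algebra\<close> below.\<close>

definition ind_space ::
  "('g, 'b) monoid_scheme \<Rightarrow> 'g set \<Rightarrow> 'v::ab_group_add set \<Rightarrow> ('g \<Rightarrow> 'v \<Rightarrow> 'v) \<Rightarrow> ('g \<Rightarrow> 'v) set" where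
  "ind_space G K V \<theta> =
     {F. (\<forall>x\<in>carrier G. F x \<in> V) \<and> (\<forall>x. x \<notin> carrier G \<longrightarrow> F x = 0) \<and>
         (\<forall>x\<in>carrier G. \<forall>k\<in>K. F (x \<otimes>\<^bsub>G\<^esub> k) = \<theta> (inv\<^bsub>G\<^esub> k) (F x))}"

definition ind_action :: "('g, 'b) monoid_scheme \<Rightarrow> 'g \<Rightarrow> ('g \<Rightarrow> 'v::ab_group_add) \<Rightarrow> ('g \<Rightarrow> 'v)" where
  "ind_action G g F = (\<lambda>x. if x \<in> carrier G then F (inv\<^bsub>G\<^esub> g \<otimes>\<^bsub>G\<^esub> x) else 0)"

definition fun_scale :: "(complex \<Rightarrow> 'v \<Rightarrow> 'v) \<Rightarrow> complex \<Rightarrow> ('g \<Rightarrow> 'v) \<Rightarrow> ('g \<Rightarrow> 'v)" where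
  "fun_scale s c F = (\<lambda>x. s c (F x))"

definition multiplicity_free_triple ::
  "('g, 'b) monoid_scheme \<Rightarrow> 'g set \<Rightarrow> (complex \<Rightarrow> 'v::ab_group_add \<Rightarrow> 'v) \<Rightarrow> ('v \<Rightarrow> 'v \<Rightarrow> complex)
    \<Rightarrow> 'v set \<Rightarrow> ('g \<Rightarrow> 'v \<Rightarrow> 'v) \<Rightarrow> bool" where
  "multiplicity_free_triple G K s ip V \<theta> \<longleftrightarrow>
     subgroup K G \<and>
     unitary_rep (G\<lparr>carrier := K\<rparr>) s ip V \<theta> \<and>
     irreducible_rep (G\<lparr>carrier := K\<rparr>) s V \<theta> \<and>
     multiplicity_free G (fun_scale s) (ind_space G K V \<theta>) (ind_action G)"

section \<open>The Hecke algebra and spherical functions\<close>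

definition group_algebra :: "('g, 'b) monoid_scheme \<Rightarrow> ('g \<Rightarrow> complex) set" where
  "group_algebra G = {f. \<forall>x. x \<notin> carrier G \<longrightarrow> f x = 0}"

definition conv :: "('g, 'b) monoid_scheme \<Rightarrow> ('g \<Rightarrow> complex) \<Rightarrow> ('g \<Rightarrow> complex) \<Rightarrow> ('g \<Rightarrow> complex)" where
  "conv G f1 f2 = (\<lambda>g. if g \<in> carrier G
     then (\<Sum>h\<in>carrier G. f1 (g \<otimes>\<^bsub>G\<^esub> h) * f2 (inv\<^bsub>G\<^esub> h)) else 0)"

definition psi ::
  "'g set \<Rightarrow> (complex \<Rightarrow> 'v::ab_group_add \<Rightarrow> 'v) \<Rightarrow> ('v \<Rightarrow> 'v \<Rightarrow> complex) \<Rightarrow> 'v set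
    \<Rightarrow> ('g \<Rightarrow> 'v \<Rightarrow> 'v) \<Rightarrow> 'v \<Rightarrow> 'g \<Rightarrow> complex" where
  "psi K s ip V \<theta> v = (\<lambda>k. if k \<in> K
     then of_nat (vector_space.dim s V) / of_nat (card K) * ip v (\<theta> k v) else 0)"

definition hecke_algebra :: "('g, 'b) monoid_scheme \<Rightarrow> ('g \<Rightarrow> complex) \<Rightarrow> ('g \<Rightarrow> complex) set" where
  "hecke_algebra G \<psi> = {f \<in> group_algebra G. f = conv G (conv G \<psi> f) \<psi>}"

definition spherical :: "('g, 'b) monoid_scheme \<Rightarrow> ('g \<Rightarrow> complex) \<Rightarrow> ('g \<Rightarrow> complex) \<Rightarrow> bool" where
  "spherical G \<psi> \<phi> \<longleftrightarrow>
     \<phi> \<in> hecke_algebra G \<psi> \<and> \<phi> \<one>\<^bsub>G\<^esub> = 1 \<and>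
     (\<forall>f\<in>hecke_algebra G \<psi>. \<exists>c::complex. conv G \<phi> f = (\<lambda>g. c * \<phi> g))"

end

theory Submission
  imports Defs "HOL-Computational_Algebra.Fundamental_Theorem_Algebra"
begin

text \<open>By Schur's lemma the operator \<open>x \<mapsto> \<Sum>k\<in>K. \<langle>x, \<theta>(k)v\<rangle> \<theta>(k)v\<close> is a scalar, and its trace
  identifies the scalar as \<open>|K| / d\<close>; this makes \<open>\<psi>\<close> an idempotent with \<open>cnj \<psi>(k) = \<psi>(k\<^sup>-\<^sup>1)\<close>.
  For such an idempotent, the left-hand side of the functional equation is
  \<open>(\<phi> * \<delta> * \<psi>)(g)\<close> with \<open>\<delta>\<close> the point mass at \<open>h\<^sup>-\<^sup>1\<close>. If \<open>\<phi>\<close> is spherical, it is an eigenvector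
  of right convolution by \<open>\<psi> * \<delta> * \<psi>\<close>, and evaluating at \<open>g = 1\<close> gives the eigenvalue \<open>\<phi>(h)\<close>. Conversely,
  idempotency forces \<open>\<phi>(1) = 1\<close>, and then \<open>\<phi> * f\<close> is the combination of the \<open>\<phi> * \<delta> * \<psi>\<close>
  with coefficients \<open>f(h\<^sup>-\<^sup>1)\<close>.\<close>

section \<open>Eigenvectors and Schur's lemma\<close>

lemma linear_between_0:
  assumes "linear_between s V t W T" and "0 \<in> V"
  shows "T 0 = 0"
proof -
  have "T (0 + 0) = T 0 + T 0"
    using assms unfolding linear_between_def by blast
  then show ?thesis by simp
qed

text \<open>This is p(T)x, written as an explicit sum because \<open>T\<close> will be linear only
  on \<open>V\<close>, not on the whole ambient type.\<close>

definition poly_act ::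
  "(complex \<Rightarrow> 'v::ab_group_add \<Rightarrow> 'v) \<Rightarrow> ('v \<Rightarrow> 'v) \<Rightarrow> complex poly \<Rightarrow> 'v \<Rightarrow> 'v" where
  "poly_act s T p x = (\<Sum>i\<le>degree p. s (coeff p i) ((T ^^ i) x))"

context
  fixes s :: "complex \<Rightarrow> 'v::ab_group_add \<Rightarrow> 'v" and V :: "'v set" and T :: "'v \<Rightarrow> 'v"
  assumes vs: "vector_space s" and sub: "module.subspace s V"
    and lin: "linear_between s V s V T"
begin

interpretation vector_space s by (rule vs)

lemma endo_funpow_in: "x \<in> V \<Longrightarrow> (T ^^ i) x \<in> V"
  using lin by (induction i) (auto simp: linear_between_def)

lemma endo_sum:
  assumes "finite A" and "\<And>i. i \<in> A \<Longrightarrow> f i \<in> V"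
  shows "T (\<Sum>i\<in>A. f i) = (\<Sum>i\<in>A. T (f i))"
  using assms
proof (induction A)
  case empty
  show ?case using linear_between_0[OF lin subspace_0[OF sub]] by simp
next
  case (insert a A)
  have "sum f A \<in> V" using insert by (intro subspace_sum[OF sub]) auto
  with insert lin show ?case by (simp add: linear_between_def)
qed

text \<open>Padding by zero coefficients lets polynomials of different degrees share one index
  range.\<close>

lemma poly_act_extend:
  assumes "degree p \<le> n"
  shows "poly_act s T p x = (\<Sum>i\<le>n. s (coeff p i) ((T ^^ i) x))"
  unfolding poly_act_def
  using assms by (intro sum.mono_neutral_left) (auto simp: coeff_eq_0)

lemma poly_act_in: "x \<in> V \<Longrightarrow> poly_act s T p x \<in> V"
  unfolding poly_act_def
  by (intro subspace_sum[OF sub] subspace_scale[OF sub] endo_funpow_in)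

text \<open>Multiplication by X shifts the coefficients by one, which on iterates of
  \<open>T\<close> is one further application of \<open>T\<close>.\<close>

lemma poly_act_linear_factor:
  assumes x: "x \<in> V"
  shows "poly_act s T ([:- z, 1:] * q) x = T (poly_act s T q x) - s z (poly_act s T q x)"
proof -
  let ?n = "degree q"
  have eq: "[:- z, 1:] * q = pCons 0 q - smult z q" by simp
  \<comment> \<open>Only an upper bound, since \<open>q\<close> may be zero.\<close>
  have "degree ([:- z, 1:] * q) \<le> Suc ?n"
    by (rule order_trans[OF degree_mult_le]) simp
  then have "poly_act s T ([:- z, 1:] * q) x
      = (\<Sum>i\<le>Suc ?n. s (coeff (pCons 0 q) i) ((T ^^ i) x) - s z (s (coeff q i) ((T ^^ i) x)))"
    unfolding eq by (subst poly_act_extend) (simp_all add: scale_left_diff_distrib del: sum.atMost_Suc)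
  also have "\<dots> = (\<Sum>i\<le>Suc ?n. s (coeff (pCons 0 q) i) ((T ^^ i) x)) - s z (poly_act s T q x)"
    by (subst poly_act_extend[of q "Suc ?n"])
       (simp_all only: sum_subtractf scale_sum_right le_SucI le_refl)
  also have "(\<Sum>i\<le>Suc ?n. s (coeff (pCons 0 q) i) ((T ^^ i) x)) = (\<Sum>i\<le>?n. s (coeff q i) ((T ^^ Suc i) x))"
    by (subst sum.atMost_Suc_shift) simp
  also have "\<dots> = T (poly_act s T q x)"
    unfolding poly_act_def using x lin
    by (subst endo_sum) (auto simp: linear_between_def endo_funpow_in intro!: subspace_scale[OF sub])
  finally show ?thesis .
qed

text \<open>The \<open>card B + 1\<close> vectors x, Tx, T^2 x, ... lie in the span of
  \<open>card B\<close> vectors, so they satisfy a linear relation, whose coefficients form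
  \<open>p\<close>.\<close>

lemma annihilating_poly_exists:
  assumes B: "finite B" "V \<subseteq> span B" and x: "x \<in> V"
  obtains p where "p \<noteq> 0" and "poly_act s T p x = 0"
proof (cases "inj_on (\<lambda>i. (T ^^ i) x) {..card B}")
  case True
  let ?S = "(\<lambda>i. (T ^^ i) x) ` {..card B}"
  have "card ?S = Suc (card B)" using True by (simp add: card_image)
  moreover have "?S \<subseteq> span B" using B(2) x endo_funpow_in by blast
  ultimately have "dependent ?S"
    using independent_span_bound[OF B(1), of ?S] by auto
  then obtain u y where u: "y \<in> ?S" "u y \<noteq> 0" "(\<Sum>w\<in>?S. s (u w) w) = 0"
    by (auto simp: dependent_finite)
  then obtain j where j: "j \<le> card B" "u ((T ^^ j) x) \<noteq> 0" by auto
  define p where "p = (\<Sum>i\<le>card B. monom (u ((T ^^ i) x)) i)"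
  have co: "coeff p i = (if i \<le> card B then u ((T ^^ i) x) else 0)" for i
    by (simp add: p_def coeff_sum)
  have "degree p \<le> card B" by (rule degree_le) (simp add: co)
  then have "poly_act s T p x = (\<Sum>i\<le>card B. s (u ((T ^^ i) x)) ((T ^^ i) x))"
    by (subst poly_act_extend) (auto simp: co intro!: sum.cong)
  also have "\<dots> = 0" using u(3) True by (simp add: sum.reindex)
  finally have "poly_act s T p x = 0" .
  moreover have "p \<noteq> 0" using j co[of j] by auto
  ultimately show thesis by (rule that[rotated])
next
  case False
  \<comment> \<open>Dependence is a property of sets and does not see repeated vectors; a repetition
    among the iterates gives the relation X^i - X^j directly.\<close>
  then obtain i j where ij: "i \<noteq> j" "(T ^^ i) x = (T ^^ j) x" by (auto simp: inj_on_def)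
  define p :: "complex poly" where "p = monom 1 i - monom 1 j"
  have co: "coeff p k = (if k = i then 1 else 0) - (if k = j then 1 else 0)" for k
    by (simp add: p_def)
  have "degree p \<le> i + j" by (rule degree_le) (simp add: co)
  then have "poly_act s T p x
      = (\<Sum>k\<le>i+j. s (if k = i then 1 else 0) ((T ^^ k) x)) - (\<Sum>k\<le>i+j. s (if k = j then 1 else 0) ((T ^^ k) x))"
    by (subst poly_act_extend) (simp_all add: co scale_left_diff_distrib sum_subtractf)
  also have "\<dots> = (T ^^ i) x - (T ^^ j) x"
    by (simp add: if_distrib[of "\<lambda>c. s c _"] cong: if_cong)
  finally have "poly_act s T p x = 0" using ij by simp
  moreover have "p \<noteq> 0" using ij(1) co[of i] by auto
  ultimately show thesis by (rule that[rotated])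
qed

text \<open>Take \<open>p\<close> of least degree annihilating \<open>x\<close> and split off a
  root, p = (X - z) q. By minimality q(T)x is nonzero, and T - z kills it.\<close>

lemma eigenvector_exists:
  assumes B: "finite B" "V \<subseteq> span B" and x: "x \<in> V" "x \<noteq> 0"
  obtains c y where "y \<in> V" and "y \<noteq> 0" and "T y = s c y"
proof -
  let ?A = "\<lambda>p. p \<noteq> 0 \<and> poly_act s T p x = 0"
  obtain p where p: "?A p" and min: "\<And>q. ?A q \<Longrightarrow> degree p \<le> degree q"
    using annihilating_poly_exists[OF B x(1)] ex_has_least_nat[of ?A _ degree] by metis
  have "degree p \<noteq> 0"
  proof
    assume "degree p = 0"
    then obtain a where "p = [:a:]" by (rule degree_eq_zeroE)
    with p x(2) show False by (simp add: poly_act_def)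
  qed
  then obtain z where "poly p z = 0"
    using alg_closed_imp_poly_has_root[of p] by auto
  then obtain q where q: "p = [:- z, 1:] * q" by (auto simp: poly_eq_0_iff_dvd)
  with p have "q \<noteq> 0" by auto
  then have "degree p = Suc (degree q)" unfolding q by (subst degree_mult_eq) auto
  with min[of q] \<open>q \<noteq> 0\<close> have "poly_act s T q x \<noteq> 0" by auto
  moreover have "T (poly_act s T q x) = s z (poly_act s T q x)"
    using p poly_act_linear_factor[OF x(1), of z q] unfolding q by simp
  ultimately show thesis using poly_act_in[OF x(1)] that by blast
qed

end

text \<open>An eigenspace of \<open>T\<close> is invariant because \<open>T\<close> commutes with
  the action, and a nonzero one is all of \<open>V\<close> by irreducibility.\<close>

lemma irreducible_rep_schur:
  assumes irr: "irreducible_rep H s V \<rho>"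
    and lin: "linear_between s V s V T"
    and comm: "\<And>g x. g \<in> carrier H \<Longrightarrow> x \<in> V \<Longrightarrow> T (\<rho> g x) = \<rho> g (T x)"
  obtains c where "\<And>x. x \<in> V \<Longrightarrow> T x = s c x"
proof -
  have rep: "group_rep H s V \<rho>" and nz: "V \<noteq> {0}"
    and inv: "\<And>U. invariant_subspace H s V \<rho> U \<Longrightarrow> U = {0} \<or> U = V"
    using irr by (auto simp: irreducible_rep_def)
  have vs: "vector_space s" and sub: "module.subspace s V"
    using rep by (auto simp: group_rep_def)
  interpret vector_space s by (rule vs)
  obtain B where B: "finite B" "V = span B" using rep by (auto simp: group_rep_def)
  obtain x where x: "x \<in> V" "x \<noteq> 0" using nz subspace_0[OF sub] by blast
  obtain c y where y: "y \<in> V" "y \<noteq> 0" "T y = s c y"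
    using eigenvector_exists[OF vs sub lin B(1) _ x] B(2) by blast
  have \<rho>: "linear_between s V s V (\<rho> g)" if "g \<in> carrier H" for g
    using rep that by (auto simp: group_rep_def)
  let ?U = "{x \<in> V. T x = s c x}"
  have "subspace ?U"
    unfolding subspace_def
    using lin linear_between_0[OF lin subspace_0[OF sub]] sub
    by (auto simp: linear_between_def subspace_def scale_right_distrib scale_left_commute)
  moreover have "\<rho> g x \<in> ?U" if "g \<in> carrier H" "x \<in> ?U" for g x
    using \<rho>[OF that(1)] that comm by (auto simp: linear_between_def)
  ultimately have "invariant_subspace H s V \<rho> ?U" by (auto simp: invariant_subspace_def)
  with inv y have "?U = V" by blast
  then show thesis using that by blast
qed

section \<open>Idempotency of the matrix coefficient\<close>

context
  fixes s :: "complex \<Rightarrow> 'v::ab_group_add \<Rightarrow> 'v" and V :: "'v set" and ip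
  assumes vs: "vector_space s" and sub: "module.subspace s V"
    and ip: "hermitian_ip s V ip"
begin

interpretation vector_space s by (rule vs)

lemma hermitian_ip_add: "x \<in> V \<Longrightarrow> y \<in> V \<Longrightarrow> z \<in> V \<Longrightarrow> ip (x + y) z = ip x z + ip y z"
  and hermitian_ip_scale: "x \<in> V \<Longrightarrow> y \<in> V \<Longrightarrow> ip (s c x) y = c * ip x y"
  and hermitian_ip_cnj: "x \<in> V \<Longrightarrow> y \<in> V \<Longrightarrow> ip y x = cnj (ip x y)"
  using ip unfolding hermitian_ip_def by blast+

lemma hermitian_ip_sum:
  assumes "finite A" and "\<And>i. i \<in> A \<Longrightarrow> f i \<in> V" and "z \<in> V"
  shows "ip (\<Sum>i\<in>A. f i) z = (\<Sum>i\<in>A. ip (f i) z)"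
  using assms
proof (induction A)
  case empty
  have "ip (s 0 z) z = 0" using hermitian_ip_scale[of z z 0] empty by simp
  then show ?case by simp
next
  case (insert a A)
  have "sum f A \<in> V" using insert by (intro subspace_sum[OF sub]) auto
  with insert show ?case by (simp add: hermitian_ip_add)
qed

text \<open>Taking traces: in a basis \<open>B\<close>, the rank one operator \<open>x \<mapsto> ip x u \<cdot> u\<close> has trace \<open>ip u u\<close>.\<close>

lemma scalar_frame_operator:
  assumes fin: "finite B0" "V = span B0" and I: "finite I" and u: "\<And>i. i \<in> I \<Longrightarrow> u i \<in> V"
    and scalar: "\<And>x. x \<in> V \<Longrightarrow> (\<Sum>i\<in>I. s (ip x (u i)) (u i)) = s c x"
  shows "c * of_nat (dim V) = (\<Sum>i\<in>I. ip (u i) (u i))"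
proof -
  obtain B where B: "B \<subseteq> V" "independent B" "V \<subseteq> span B" "card B = dim V"
    by (rule basis_exists)
  have finB: "finite B"
    using independent_span_bound[OF fin(1) B(2)] B(1) fin(2) by blast
  have uB: "u i \<in> span B" if "i \<in> I" for i using u[OF that] B(3) by blast
  let ?r = "representation B"
  \<comment> \<open>A diagonal matrix entry: the coefficient of \<open>b\<close> in the image of
    \<open>b\<close>, which is \<open>c\<close> for a scalar operator.\<close>
  have diag: "(\<Sum>i\<in>I. ip b (u i) * ?r (u i) b) = c" if b: "b \<in> B" for b
  proof -
    have bs: "b \<in> span B" using b by (rule span_base)
    have "?r (\<Sum>i\<in>I. s (ip b (u i)) (u i)) b = (\<Sum>i\<in>I. ip b (u i) * ?r (u i) b)"
      using B(2) uB by (simp add: representation_sum representation_scale span_scale)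
    moreover have "?r (s c b) b = c"
      using B(2) b bs by (simp add: representation_scale representation_basis)
    ultimately show ?thesis using scalar[of b] b B(1) by auto
  qed
  have "c * of_nat (dim V) = (\<Sum>b\<in>B. c)" using B(4) by simp
  also have "\<dots> = (\<Sum>b\<in>B. \<Sum>i\<in>I. ip b (u i) * ?r (u i) b)" by (simp add: diag)
  also have "\<dots> = (\<Sum>i\<in>I. \<Sum>b\<in>B. ip b (u i) * ?r (u i) b)" by (rule sum.swap)
  also have "\<dots> = (\<Sum>i\<in>I. ip (u i) (u i))"
  proof (rule sum.cong[OF refl])
    fix i assume i: "i \<in> I"
    have "ip (\<Sum>b\<in>B. s (?r (u i) b) b) (u i) = (\<Sum>b\<in>B. ip b (u i) * ?r (u i) b)"
      using finB B(1) u[OF i] subspace_scale[OF sub]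
      by (subst hermitian_ip_sum) (auto simp: hermitian_ip_scale subset_iff mult.commute intro!: sum.cong)
    moreover have "(\<Sum>b\<in>B. s (?r (u i) b) b) = u i"
      by (rule sum_representation_eq[OF B(2) uB[OF i] finB order_refl])
    ultimately show "(\<Sum>b\<in>B. ip b (u i) * ?r (u i) b) = ip (u i) (u i)" by simp
  qed
  finally show ?thesis .
qed

end

text \<open>The norm sees only the real part; Hermitian symmetry makes the imaginary part
  vanish.\<close>

lemma ip_self_eq_1:
  assumes "hermitian_ip s V ip" and "v \<in> V" and "ip_norm ip v = 1"
  shows "ip v v = 1"
proof -
  have "ip v v = cnj (ip v v)" using assms(1,2) unfolding hermitian_ip_def by blast
  moreover have "Re (ip v v) = 1" using assms(3) by (simp add: ip_norm_def)
  ultimately show ?thesis by (simp add: complex_eq_iff)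
qed

section \<open>Orthogonality of matrix coefficients\<close>

lemma (in group) sum_translate:
  assumes "a \<in> carrier G"
  shows "(\<Sum>h\<in>carrier G. F (a \<otimes> h)) = (\<Sum>h\<in>carrier G. F h)"
  using assms
  by (intro sum.reindex_bij_witness[of _ "\<lambda>h. inv a \<otimes> h" "\<lambda>h. a \<otimes> h"])
     (auto simp: m_assoc[symmetric])

lemma (in group) sum_inverse: "(\<Sum>h\<in>carrier G. F (inv h)) = (\<Sum>h\<in>carrier G. F h)"
  by (intro sum.reindex_bij_witness[of _ "\<lambda>h. inv h" "\<lambda>h. inv h"]) auto

text \<open>The operator \<open>P\<close> below commutes with the action, so it is a scalar known
  from its trace; pairing \<open>P x\<close> with \<open>y\<close> gives the sum. The dimension
  stands as a factor on the left, which avoids dividing by it.\<close>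

lemma (in group) matrix_coefficient_orthogonality:
  assumes fin: "finite (carrier G)" and uni: "unitary_rep G s ip V \<rho>"
    and irr: "irreducible_rep G s V \<rho>"
    and V: "v \<in> V" "x \<in> V" "y \<in> V"
  shows "of_nat (vector_space.dim s V) * (\<Sum>h\<in>carrier G. ip x (\<rho> h v) * ip (\<rho> h v) y)
    = of_nat (card (carrier G)) * ip v v * ip x y"
proof -
  have rep: "group_rep G s V \<rho>" and hip: "hermitian_ip s V ip"
    and inv_ip: "\<And>g x y. g \<in> carrier G \<Longrightarrow> x \<in> V \<Longrightarrow> y \<in> V \<Longrightarrow> ip (\<rho> g x) (\<rho> g y) = ip x y"
    using uni by (auto simp: unitary_rep_def)
  have vs: "vector_space s" and sub: "module.subspace s V"
    and lin: "\<And>g. g \<in> carrier G \<Longrightarrow> linear_between s V s V (\<rho> g)"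
    and mult: "\<And>g h x. g \<in> carrier G \<Longrightarrow> h \<in> carrier G \<Longrightarrow> x \<in> V \<Longrightarrow> \<rho> (g \<otimes> h) x = \<rho> g (\<rho> h x)"
    using rep by (auto simp: group_rep_def)
  interpret vector_space s by (rule vs)
  obtain B where B: "finite B" "V = span B" using rep by (auto simp: group_rep_def)
  have inV: "\<rho> g x \<in> V" if "g \<in> carrier G" "x \<in> V" for g x
    using lin[OF that(1)] that(2) by (auto simp: linear_between_def)
  note ip_add = hermitian_ip_add[OF vs sub hip] and ip_scale = hermitian_ip_scale[OF vs sub hip]
    and ip_sum = hermitian_ip_sum[OF vs sub hip]
  define P where "P x = (\<Sum>h\<in>carrier G. s (ip x (\<rho> h v)) (\<rho> h v))" for x
  have PV: "P x \<in> V" if "x \<in> V" for x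
    unfolding P_def by (intro subspace_sum[OF sub] subspace_scale[OF sub] inV V(1))
  have "linear_between s V s V P"
    unfolding linear_between_def
    using PV V(1) inV
    by (auto simp: P_def ip_add ip_scale scale_left_distrib sum.distrib scale_sum_right)
  moreover have "P (\<rho> g x) = \<rho> g (P x)" if g: "g \<in> carrier G" and x: "x \<in> V" for g x
  proof -
    \<comment> \<open>After replacing h by gh, unitarity removes g from the inner product and leaves
      it only on the vector.\<close>
    have "P (\<rho> g x) = (\<Sum>h\<in>carrier G. s (ip (\<rho> g x) (\<rho> (g \<otimes> h) v)) (\<rho> (g \<otimes> h) v))"
      unfolding P_def by (rule sum_translate[OF g, symmetric])
    also have "\<dots> = (\<Sum>h\<in>carrier G. \<rho> g (s (ip x (\<rho> h v)) (\<rho> h v)))"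
      using g x V(1) inV lin[OF g]
      by (intro sum.cong refl) (auto simp: mult inv_ip linear_between_def)
    also have "\<dots> = \<rho> g (P x)"
      unfolding P_def
      using fin V(1) inV subspace_scale[OF sub] by (intro endo_sum[OF vs sub lin[OF g], symmetric]) auto
    finally show ?thesis .
  qed
  ultimately obtain c where c: "\<And>x. x \<in> V \<Longrightarrow> P x = s c x"
    using irreducible_rep_schur[OF irr] by blast
  have "c * of_nat (dim V) = (\<Sum>h\<in>carrier G. ip (\<rho> h v) (\<rho> h v))"
    using scalar_frame_operator[OF vs sub hip B fin, of "\<lambda>h. \<rho> h v" c] inV V(1) c
    by (simp add: P_def)
  also have "\<dots> = of_nat (card (carrier G)) * ip v v" using V(1) by (simp add: inv_ip)
  finally have cd: "c * of_nat (dim V) = of_nat (card (carrier G)) * ip v v" .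
  have "(\<Sum>h\<in>carrier G. ip x (\<rho> h v) * ip (\<rho> h v) y) = ip (P x) y"
    unfolding P_def using fin V inV subspace_scale[OF sub]
    by (subst ip_sum) (auto simp: ip_scale intro!: sum.cong)
  also have "\<dots> = c * ip x y" using c V by (simp add: ip_scale)
  finally show ?thesis using cd by (simp add: mult_ac)
qed

text \<open>Unitarity moves \<theta>(k) to the other argument as its inverse, and conjugation swaps
  the two arguments.\<close>

lemma (in group) cnj_psi:
  assumes K: "subgroup K G"
    and uni: "unitary_rep (G\<lparr>carrier := K\<rparr>) s ip V \<theta>" and v: "v \<in> V" and k: "k \<in> K"
  shows "cnj (psi K s ip V \<theta> v k) = psi K s ip V \<theta> v (inv k)"
proof -
  have kG: "k \<in> carrier G" and ik: "inv k \<in> K" using K k by (auto dest: subgroup.mem_carrier subgroup.m_inv_closed)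
  have rep: "group_rep (G\<lparr>carrier := K\<rparr>) s V \<theta>" and hip: "hermitian_ip s V ip"
    and inv_ip: "\<And>g x y. g \<in> K \<Longrightarrow> x \<in> V \<Longrightarrow> y \<in> V \<Longrightarrow> ip (\<theta> g x) (\<theta> g y) = ip x y"
    using uni by (auto simp: unitary_rep_def)
  have kV: "\<theta> k v \<in> V" using rep k v by (auto simp: group_rep_def linear_between_def)
  have "\<theta> (inv k) (\<theta> k v) = \<theta> (inv k \<otimes> k) v"
    using rep k ik v by (simp add: group_rep_def)
  also have "\<dots> = v" using rep v kG by (auto simp: group_rep_def)
  finally have "ip (\<theta> k v) v = ip v (\<theta> (inv k) v)"
    using inv_ip[OF ik kV v] by simp
  moreover have "ip (\<theta> k v) v = cnj (ip v (\<theta> k v))"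
    using hip v kV unfolding hermitian_ip_def by blast
  ultimately show ?thesis using k ik by (simp add: psi_def)
qed

text \<open>On \<open>K\<close> the convolution is a sum of products of matrix coefficients, which
  orthogonality evaluates; off \<open>K\<close> every summand vanishes.\<close>

lemma (in group) psi_idempotent:
  assumes fin: "finite (carrier G)" and K: "subgroup K G"
    and uni: "unitary_rep (G\<lparr>carrier := K\<rparr>) s ip V \<theta>"
    and irr: "irreducible_rep (G\<lparr>carrier := K\<rparr>) s V \<theta>"
    and v: "v \<in> V" and vv: "ip v v = 1"
  shows "conv G (psi K s ip V \<theta> v) (psi K s ip V \<theta> v) = psi K s ip V \<theta> v" (is "conv G ?\<psi> ?\<psi> = _")
proof
  fix g
  interpret K: group "G\<lparr>carrier := K\<rparr>" using K by (rule subgroup_imp_group)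
  have KG: "K \<subseteq> carrier G" using K by (rule subgroup.subset)
  have finK: "finite K" using KG fin by (rule finite_subset)
  have "\<one> \<in> K" using K by (rule subgroup.one_closed)
  with finK have cardK: "card K \<noteq> 0" by auto
  note closed = subgroup.m_closed[OF K] subgroup.m_inv_closed[OF K]
  let ?d = "vector_space.dim s V"
  have rep: "group_rep (G\<lparr>carrier := K\<rparr>) s V \<theta>"
    and inv_ip: "\<And>g x y. g \<in> K \<Longrightarrow> x \<in> V \<Longrightarrow> y \<in> V \<Longrightarrow> ip (\<theta> g x) (\<theta> g y) = ip x y"
    using uni by (auto simp: unitary_rep_def)
  have inV: "\<And>g x. g \<in> K \<Longrightarrow> x \<in> V \<Longrightarrow> \<theta> g x \<in> V"
    and mult: "\<And>g h x. g \<in> K \<Longrightarrow> h \<in> K \<Longrightarrow> x \<in> V \<Longrightarrow> \<theta> (g \<otimes> h) x = \<theta> g (\<theta> h x)"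
    and one: "\<And>x. x \<in> V \<Longrightarrow> \<theta> \<one> x = x"
    using rep by (auto simp: group_rep_def linear_between_def)
  have cancel: "\<theta> h (\<theta> (inv h) v) = v" if "h \<in> K" for h
    using mult[OF that closed(2)[OF that] v] that KG one[OF v] by (auto simp: subset_iff)
  show "conv G ?\<psi> ?\<psi> g = ?\<psi> g"
  proof (cases "g \<in> K")
    case False
    \<comment> \<open>If both arguments were in \<open>K\<close>, so would be their product, which
      is g.\<close>
    have "?\<psi> (g \<otimes> h) * ?\<psi> (inv h) = 0" if g: "g \<in> carrier G" and h: "h \<in> carrier G" for h
    proof (cases "inv h \<in> K \<and> g \<otimes> h \<in> K")
      case True
      then have "g \<otimes> h \<otimes> inv h \<in> K" using closed by blast
      with g h False show ?thesis by (simp add: m_assoc)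
    qed (auto simp: psi_def)
    then have "conv G ?\<psi> ?\<psi> g = 0"
      unfolding conv_def by (auto simp del: mult_eq_0_iff intro!: sum.neutral)
    with False show ?thesis by (simp add: psi_def)
  next
    case True
    \<comment> \<open>Moving g onto the first argument leaves the second one depending on h alone,
      as the orthogonality relation requires.\<close>
    define w where "w = \<theta> (inv g) v"
    have w: "w \<in> V" "\<theta> g w = v" using True closed v inV cancel by (auto simp: w_def)
    have summand: "?\<psi> (g \<otimes> h) * ?\<psi> (inv h)
        = (of_nat ?d / of_nat (card K))\<^sup>2 * (ip w (\<theta> h v) * ip (\<theta> h v) v)" if h: "h \<in> K" for h
    proof -
      have "ip v (\<theta> (g \<otimes> h) v) = ip (\<theta> g w) (\<theta> g (\<theta> h v))" using True h v w(2) by (simp add: mult)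
      also have "\<dots> = ip w (\<theta> h v)" by (rule inv_ip[OF True w(1) inV[OF h v]])
      finally have "ip v (\<theta> (g \<otimes> h) v) = ip w (\<theta> h v)" .
      moreover have "ip v (\<theta> (inv h) v) = ip (\<theta> h v) v"
        using inv_ip[OF h v inV[OF closed(2)[OF h] v]] cancel[OF h] by simp
      ultimately show ?thesis
        using True h closed by (simp add: psi_def power2_eq_square)
    qed
    have "conv G ?\<psi> ?\<psi> g = (\<Sum>h\<in>carrier G. ?\<psi> (g \<otimes> h) * ?\<psi> (inv h))"
      using True KG by (auto simp: conv_def)
    also have "\<dots> = (\<Sum>h\<in>K. ?\<psi> (g \<otimes> h) * ?\<psi> (inv h))"
    proof (intro sum.mono_neutral_right fin KG ballI)
      fix h assume "h \<in> carrier G - K"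
      then have "inv h \<notin> K" using closed(2)[of "inv h"] by auto
      then show "?\<psi> (g \<otimes> h) * ?\<psi> (inv h) = 0" by (simp add: psi_def)
    qed
    also have "\<dots> = (of_nat ?d / of_nat (card K))\<^sup>2 * (\<Sum>h\<in>K. ip w (\<theta> h v) * ip (\<theta> h v) v)"
      by (simp add: summand sum_distrib_left)
    \<comment> \<open>One factor of the dimension stays with the sum, to match the left side of the
      orthogonality relation.\<close>
    also have "\<dots> = of_nat ?d / (of_nat (card K))\<^sup>2 * (of_nat ?d * (\<Sum>h\<in>K. ip w (\<theta> h v) * ip (\<theta> h v) v))"
      by (simp add: power2_eq_square)
    also have "of_nat ?d * (\<Sum>h\<in>K. ip w (\<theta> h v) * ip (\<theta> h v) v) = of_nat (card K) * ip w v"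
      using K.matrix_coefficient_orthogonality[OF _ uni irr v w(1) v] finK vv by simp
    also have "ip w v = ip v (\<theta> g v)" using inv_ip[OF True w(1) v] w(2) by simp
    finally show ?thesis using True cardK by (simp add: psi_def power2_eq_square)
  qed
qed

section \<open>The functional equation\<close>

context group
begin

text \<open>Exchange the two sums, then substitute ba for a in the inner one, so that b is absorbed
  into the argument of \<open>f1\<close>.\<close>

lemma conv_assoc:
  assumes "finite (carrier G)"
  shows "conv G (conv G f1 f2) f3 = conv G f1 (conv G f2 f3)"
proof
  fix g
  show "conv G (conv G f1 f2) f3 g = conv G f1 (conv G f2 f3) g"
  proof (cases "g \<in> carrier G")
    case g: True
    have "conv G f1 (conv G f2 f3) g
        = (\<Sum>a\<in>carrier G. \<Sum>b\<in>carrier G. f1 (g \<otimes> a) * (f2 (inv a \<otimes> b) * f3 (inv b)))"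
      using g by (simp add: conv_def sum_distrib_left)
    also have "\<dots> = (\<Sum>b\<in>carrier G. \<Sum>a\<in>carrier G. f1 (g \<otimes> a) * (f2 (inv a \<otimes> b) * f3 (inv b)))"
      by (rule sum.swap)
    also have "\<dots> = (\<Sum>b\<in>carrier G. \<Sum>a\<in>carrier G. f1 (g \<otimes> (b \<otimes> a)) * (f2 (inv (b \<otimes> a) \<otimes> b) * f3 (inv b)))"
      by (intro sum.cong refl sum_translate[symmetric])
    also have "\<dots> = (\<Sum>b\<in>carrier G. \<Sum>a\<in>carrier G. f1 (g \<otimes> b \<otimes> a) * f2 (inv a) * f3 (inv b))"
      using g by (intro sum.cong refl) (simp add: inv_mult_group m_assoc)
    also have "\<dots> = conv G (conv G f1 f2) f3 g"
      using g by (simp add: conv_def sum_distrib_right)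
    finally show ?thesis by simp
  qed (simp add: conv_def)
qed

text \<open>A change of variable moves g from the first factor to the second; in this form \<psi> *
  \<phi> is recognised in the functional equation at g = 1.\<close>

lemma conv_eq_sum_right:
  assumes "g \<in> carrier G"
  shows "conv G f1 f2 g = (\<Sum>h\<in>carrier G. f1 (inv h) * f2 (h \<otimes> g))"
proof -
  have "conv G f1 f2 g = (\<Sum>h\<in>carrier G. f1 (g \<otimes> (inv g \<otimes> h)) * f2 (inv (inv g \<otimes> h)))"
    using assms by (simp add: conv_def sum_translate[where F = "\<lambda>h. f1 (g \<otimes> h) * f2 (inv h)"])
  also have "\<dots> = (\<Sum>h\<in>carrier G. f1 h * f2 (inv h \<otimes> g))"
    using assms by (intro sum.cong refl) (simp add: m_assoc[symmetric] inv_mult_group)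
  also have "\<dots> = (\<Sum>h\<in>carrier G. f1 (inv h) * f2 (inv (inv h) \<otimes> g))"
    by (rule sum_inverse[symmetric])
  finally show ?thesis by (simp cong: sum.cong)
qed

definition delta :: "'a \<Rightarrow> 'a \<Rightarrow> complex" where
  "delta x g = (if g = x then 1 else 0)"

lemma conv_delta_inv:
  assumes "finite (carrier G)" and "h \<in> carrier G" and "g \<in> carrier G"
  shows "conv G f (delta (inv h)) g = f (g \<otimes> h)"
proof -
  have "conv G f (delta (inv h)) g = (\<Sum>a\<in>carrier G. if a = h then f (g \<otimes> a) else 0)"
    unfolding conv_def if_P[OF assms(3)] delta_def
    using assms(2) inj_onD[OF inv_inj, of _ h] by (intro sum.cong refl) auto
  with assms show ?thesis by simp
qed

text \<open>Makes associativity available for the left-hand side of the functional equation.\<close>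

lemma conv_delta_conv:
  assumes "finite (carrier G)" and "h \<in> carrier G" and "g \<in> carrier G"
  shows "conv G (conv G f (delta (inv h))) \<psi> g = (\<Sum>k\<in>carrier G. f (g \<otimes> k \<otimes> h) * \<psi> (inv k))"
  using assms by (simp add: conv_def[of G "conv G f (delta (inv h))"] conv_delta_inv)

text \<open>Stated for any idempotent \<open>\<psi>\<close>, with the sum over the whole group and
  \<psi>(k^-1) in place of the conjugate, so that the argument takes place inside the group
  algebra.\<close>

theorem spherical_iff_functional_equation:
  assumes fin: "finite (carrier G)" and idem: "conv G \<psi> \<psi> = \<psi>"
    and \<phi>: "\<phi> \<in> group_algebra G" "\<phi> \<noteq> (\<lambda>_. 0)"
  shows "spherical G \<psi> \<phi> \<longleftrightarrow>
    (\<forall>g\<in>carrier G. \<forall>h\<in>carrier G. (\<Sum>k\<in>carrier G. \<phi> (g \<otimes> k \<otimes> h) * \<psi> (inv k)) = \<phi> g * \<phi> h)"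
proof
  note assoc = conv_assoc[OF fin]
  assume sph: "spherical G \<psi> \<phi>"
  have "\<phi> = conv G (conv G \<psi> \<phi>) \<psi>" and \<phi>1: "\<phi> \<one> = 1"
    using sph by (auto simp: spherical_def hecke_algebra_def)
  \<comment> \<open>Idempotency absorbs an extra \<psi> on either side, so \<phi> is fixed by left
    and by right convolution separately.\<close>
  moreover have "conv G \<psi> (conv G (conv G \<psi> \<phi>) \<psi>) = conv G (conv G \<psi> \<phi>) \<psi>"
    by (simp add: assoc[symmetric] idem)
  moreover have "conv G (conv G (conv G \<psi> \<phi>) \<psi>) \<psi> = conv G (conv G \<psi> \<phi>) \<psi>"
    by (simp add: assoc idem)
  ultimately have left: "conv G \<psi> \<phi> = \<phi>" and right: "conv G \<phi> \<psi> = \<phi>"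
    by simp_all
  show "\<forall>g\<in>carrier G. \<forall>h\<in>carrier G. (\<Sum>k\<in>carrier G. \<phi> (g \<otimes> k \<otimes> h) * \<psi> (inv k)) = \<phi> g * \<phi> h"
  proof (intro ballI)
    fix g h assume g: "g \<in> carrier G" and h: "h \<in> carrier G"
    \<comment> \<open>The projection of the point mass to the Hecke algebra, which is an admissible
      test function.\<close>
    define f where "f = conv G \<psi> (conv G (delta (inv h)) \<psi>)"
    have "conv G (conv G \<psi> f) \<psi> = conv G (conv G \<psi> \<psi>) (conv G (delta (inv h)) (conv G \<psi> \<psi>))"
      by (simp only: f_def assoc)
    then have "conv G (conv G \<psi> f) \<psi> = f" by (simp add: f_def idem)
    moreover have "f \<in> group_algebra G" by (simp add: f_def group_algebra_def conv_def)
    ultimately have "f \<in> hecke_algebra G \<psi>" by (simp add: hecke_algebra_def)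
    then obtain c where c: "conv G \<phi> f = (\<lambda>g. c * \<phi> g)"
      using sph by (auto simp: spherical_def)
    have "conv G \<phi> f = conv G (conv G \<phi> (delta (inv h))) \<psi>"
      unfolding f_def by (simp add: assoc[symmetric] right)
    then have eq: "(\<Sum>k\<in>carrier G. \<phi> (a \<otimes> k \<otimes> h) * \<psi> (inv k)) = c * \<phi> a" if "a \<in> carrier G" for a
      using conv_delta_conv[OF fin h that, of \<phi> \<psi>] fun_cong[OF c, of a] by simp
    \<comment> \<open>Since \<phi>(1) = 1, evaluation at the identity isolates the eigenvalue, and
      the sum there is (\<psi> * \<phi>)(h).\<close>
    have "c = (\<Sum>k\<in>carrier G. \<phi> (\<one> \<otimes> k \<otimes> h) * \<psi> (inv k))" using eq[of \<one>] \<phi>1 by simp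
    also have "\<dots> = conv G \<psi> \<phi> h"
      using h by (simp add: conv_eq_sum_right mult.commute cong: sum.cong)
    finally have "c = \<phi> h" using left by simp
    with eq[OF g] show "(\<Sum>k\<in>carrier G. \<phi> (g \<otimes> k \<otimes> h) * \<psi> (inv k)) = \<phi> g * \<phi> h" by simp
  qed
next
  note assoc = conv_assoc[OF fin]
  assume "\<forall>g\<in>carrier G. \<forall>h\<in>carrier G. (\<Sum>k\<in>carrier G. \<phi> (g \<otimes> k \<otimes> h) * \<psi> (inv k)) = \<phi> g * \<phi> h"
  then have fe: "(\<Sum>k\<in>carrier G. \<phi> (g \<otimes> k \<otimes> h) * \<psi> (inv k)) = \<phi> g * \<phi> h"
    if "g \<in> carrier G" "h \<in> carrier G" for g h using that by blast
  have off: "\<phi> g = 0" if "g \<notin> carrier G" for g using \<phi>(1) that by (auto simp: group_algebra_def)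
  \<comment> \<open>Setting h = 1, and next g = 1, in the functional equation; the value \<phi>(1)
    is still unknown here.\<close>
  have right: "conv G \<phi> \<psi> = (\<lambda>g. \<phi> \<one> * \<phi> g)"
    using fe[of _ \<one>] off by (auto simp: conv_def mult.commute cong: sum.cong)
  have left: "conv G \<psi> \<phi> = (\<lambda>g. \<phi> \<one> * \<phi> g)"
  proof
    fix g show "conv G \<psi> \<phi> g = \<phi> \<one> * \<phi> g"
      using fe[of \<one> g] off
      by (cases "g \<in> carrier G")
         (simp add: conv_eq_sum_right mult.commute cong: sum.cong, simp add: conv_def)
  qed
  have shift: "conv G (conv G \<phi> (delta (inv h))) \<psi> = (\<lambda>g. \<phi> h * \<phi> g)" if "h \<in> carrier G" for h
  proof
    fix g show "conv G (conv G \<phi> (delta (inv h))) \<psi> g = \<phi> h * \<phi> g"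
      using fe[OF _ that, of g] conv_delta_conv[OF fin that, of g \<phi> \<psi>] off[of g]
      by (cases "g \<in> carrier G") (simp_all add: conv_def[of G _ \<psi>])
  qed
  have scale: "conv G (\<lambda>g. c * f g) \<psi> g = c * conv G f \<psi> g" for c f g
    by (simp add: conv_def sum_distrib_left mult.assoc)
  obtain h where h: "h \<in> carrier G" "\<phi> h \<noteq> 0" using \<phi>(2) off by blast
  let ?F = "conv G (conv G \<phi> (delta (inv h))) \<psi>"
  \<comment> \<open>Convolving \<open>?F\<close> with \<psi> once more changes nothing by
    idempotency, but multiplies it by \<phi>(1) because \<open>?F\<close> is a multiple of \<phi>.
    Comparing at h, where \<phi> is nonzero, gives \<phi>(1) = 1.\<close>
  have "\<phi> h * (\<phi> \<one> * \<phi> h) = conv G ?F \<psi> h"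
    unfolding shift[OF h(1)] scale right ..
  also have "conv G ?F \<psi> = ?F" by (simp only: assoc idem)
  also have "?F h = \<phi> h * \<phi> h" unfolding shift[OF h(1)] ..
  finally have "\<phi> h * (\<phi> \<one> * \<phi> h) = \<phi> h * \<phi> h" .
  with h(2) have \<phi>1: "\<phi> \<one> = 1" by simp
  \<comment> \<open>The eigenvalue can only be (\<phi> * f)(1), which is this sum.\<close>
  have "conv G \<phi> f = (\<lambda>g. (\<Sum>h\<in>carrier G. f (inv h) * \<phi> h) * \<phi> g)" if f: "f \<in> hecke_algebra G \<psi>" for f
  proof
    fix g
    have "f = conv G (conv G \<psi> f) \<psi>" using f by (simp add: hecke_algebra_def)
    moreover have "conv G (conv G (conv G \<psi> f) \<psi>) \<psi> = conv G (conv G \<psi> f) \<psi>"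
      by (simp only: assoc idem)
    ultimately have "conv G f \<psi> = f" by simp
    \<comment> \<open>The appended \<psi> supplies the inner sum over k to which the functional
      equation applies.\<close>
    then have f_eq: "conv G \<phi> f = conv G (conv G \<phi> f) \<psi>" by (simp only: assoc)
    show "conv G \<phi> f g = (\<Sum>h\<in>carrier G. f (inv h) * \<phi> h) * \<phi> g"
    proof (cases "g \<in> carrier G")
      case g: True
      have "conv G \<phi> f g = (\<Sum>k\<in>carrier G. \<Sum>h\<in>carrier G. \<phi> (g \<otimes> k \<otimes> h) * f (inv h) * \<psi> (inv k))"
        using g by (subst f_eq) (simp add: conv_def sum_distrib_right)
      also have "\<dots> = (\<Sum>h\<in>carrier G. f (inv h) * (\<Sum>k\<in>carrier G. \<phi> (g \<otimes> k \<otimes> h) * \<psi> (inv k)))"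
        by (subst sum.swap) (simp add: sum_distrib_left mult_ac)
      also have "\<dots> = (\<Sum>h\<in>carrier G. f (inv h) * \<phi> h) * \<phi> g"
        unfolding sum_distrib_right using g by (intro sum.cong refl) (simp add: fe)
      finally show ?thesis .
    qed (simp add: conv_def off)
  qed
  moreover have "\<phi> \<in> hecke_algebra G \<psi>"
    using \<phi>(1) left right \<phi>1 by (simp add: hecke_algebra_def)
  ultimately show "spherical G \<psi> \<phi>" using \<phi>1 unfolding spherical_def by blast
qed

end

theorem theorem4p9:
  fixes G :: "('g, 'b) monoid_scheme"
    and K :: "'g set"
    and s :: "complex \<Rightarrow> 'v::ab_group_add \<Rightarrow> 'v"
    and ip :: "'v \<Rightarrow> 'v \<Rightarrow> complex"
    and V :: "'v set"
    and \<theta> :: "'g \<Rightarrow> 'v \<Rightarrow> 'v"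
    and v :: 'v
    and \<phi> :: "'g \<Rightarrow> complex"
  assumes "group G" and "finite (carrier G)"
    and "multiplicity_free_triple G K s ip V \<theta>"
    and "v \<in> V" and "ip_norm ip v = 1"
    and "\<phi> \<in> group_algebra G" and "\<phi> \<noteq> (\<lambda>_. 0)"
  shows "spherical G (psi K s ip V \<theta> v) \<phi> \<longleftrightarrow>
    (\<forall>g\<in>carrier G. \<forall>h\<in>carrier G.
       (\<Sum>k\<in>K. \<phi> (g \<otimes>\<^bsub>G\<^esub> k \<otimes>\<^bsub>G\<^esub> h) * cnj (psi K s ip V \<theta> v k)) = \<phi> g * \<phi> h)"
proof -
  interpret group G by fact
  have K: "subgroup K G" and uni: "unitary_rep (G\<lparr>carrier := K\<rparr>) s ip V \<theta>"
    and irr: "irreducible_rep (G\<lparr>carrier := K\<rparr>) s V \<theta>"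
    using assms(3) by (auto simp: multiplicity_free_triple_def)
  let ?\<psi> = "psi K s ip V \<theta> v"
  have vv: "ip v v = 1" using ip_self_eq_1[OF _ assms(4,5)] uni by (auto simp: unitary_rep_def)
  have idem: "conv G ?\<psi> ?\<psi> = ?\<psi>"
    by (rule psi_idempotent[OF assms(2) K uni irr assms(4) vv])
  have "(\<Sum>k\<in>carrier G. \<phi> (g \<otimes>\<^bsub>G\<^esub> k \<otimes>\<^bsub>G\<^esub> h) * ?\<psi> (inv\<^bsub>G\<^esub> k)) = (\<Sum>k\<in>K. \<phi> (g \<otimes>\<^bsub>G\<^esub> k \<otimes>\<^bsub>G\<^esub> h) * cnj (?\<psi> k))" for g h
  proof -
    \<comment> \<open>\<open>K\<close> is closed under inverses, so the support of \<psi> cuts the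
      sum over the group down to \<open>K\<close>.\<close>
    have "?\<psi> (inv\<^bsub>G\<^esub> k) = 0" if "k \<in> carrier G - K" for k
      using that subgroup.m_inv_closed[OF K, of "inv\<^bsub>G\<^esub> k"] by (auto simp: psi_def)
    then have "(\<Sum>k\<in>carrier G. \<phi> (g \<otimes>\<^bsub>G\<^esub> k \<otimes>\<^bsub>G\<^esub> h) * ?\<psi> (inv\<^bsub>G\<^esub> k)) = (\<Sum>k\<in>K. \<phi> (g \<otimes>\<^bsub>G\<^esub> k \<otimes>\<^bsub>G\<^esub> h) * ?\<psi> (inv\<^bsub>G\<^esub> k))"
      by (intro sum.mono_neutral_right assms(2) subgroup.subset[OF K]) auto
    then show ?thesis by (simp add: cnj_psi[OF K uni assms(4)])
  qed
  then show ?thesis using spherical_iff_functional_equation[OF assms(2) idem assms(6,7)] by simp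
qed

end
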